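(* Let $\Phi=\{\varphi_j\}_{j\in J}$ be an equiangular tight frame for $\mathbb F^d$ ($\mathbb F\in\{\mathbb R,\mathbb C\}$) whose binder $\mathcal B$, viewed as a block design on the point set $J$, is a simple affine $(v,k,\lambda)$-BIBD (with $k\ge 2$). For $\beta\in\mathcal B$ let $P_\beta$ be the orthogonal projection onto the span of $\{\varphi_j\}_{j\in\beta}$ and $W_\beta=P_\beta/(k-1)$. Then $d=\frac{(k-1)^2v}{k^2-2k+v}$, there are $\frac{v(v-1)}{k(k-1)}\lambda$ operators $W_\beta$, each satisfies $\mathrm{tr}(W_\beta)=1$ and $\mathrm{tr}(W_\beta^2)=1/(k-1)$, and $\max_{\beta\ne\beta'}\mathrm{tr}(W_\beta W_{\beta'})=1/d$ (saturation of the second Rankin bound).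
   Context: An equiangular tight frame (ETF) for a space is a spanning family of equal-norm vectors with $|\langle\varphi_j,\varphi_l\rangle|$ constant for $j\ne l$ and $\sum_j\varphi_j\varphi_j^*$ a multiple of the identity. Families $\Phi,\Psi$ are switching equivalent if $\Psi=U\Phi PD$ with $U$ unitary, $P$ a permutation, $D$ unimodular diagonal. An index set $\beta$ is a simplex if $\{\varphi_j\}_{j\in\beta}$ is switching equivalent to an ETF for a space of dimension $|\beta|-1$ with all pairwise inner products real and negative; the binder is the set of all simplices. A $(v,k,\lambda)$-BIBD is a collection of $k$-subsets (blocks) of a $v$-set with each pair of distinct points in exactly $\lambda$ blocks; simple means no repeated blocks; affine means the blocks can be partitioned into parallel classes, each partitioning the point set, with a constant $\mu$ such that blocks in different classes meet in exactly $\mu$ points. *)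

theory Defs
  imports "HOL-Analysis.Analysis" "HOL-Combinatorics.Permutations" "HOL-Library.Disjoint_Sets"
begin

text \<open>
  Uniform treatment of the two scalar fields. Every element \<open>x\<close> satisfies
  \<open>x\<^sup>2 - 2 (rc_re x) x + \<bar>x\<bar>\<^sup>2 = 0\<close>, so up to isomorphism the only models
  are the real numbers with trivial conjugation and the complex numbers with the usual one.
\<close>

class real_or_complex = real_normed_field +
  fixes rc_cnj :: "'a \<Rightarrow> 'a"
    and rc_re :: "'a \<Rightarrow> real"
  assumes rc_cnj_add: "rc_cnj (x + y) = rc_cnj x + rc_cnj y"
    and rc_cnj_mult: "rc_cnj (x * y) = rc_cnj x * rc_cnj y"
    and rc_cnj_cnj: "rc_cnj (rc_cnj x) = x"
    and rc_mult_cnj: "x * rc_cnj x = (norm x)\<^sup>2 *\<^sub>R 1"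
    and rc_add_cnj: "x + rc_cnj x = (2 * rc_re x) *\<^sub>R 1"

instantiation real :: real_or_complex
begin
definition rc_cnj_real :: "real \<Rightarrow> real" where "rc_cnj_real x = x"
definition rc_re_real :: "real \<Rightarrow> real" where "rc_re_real x = x"
instance
  by standard (simp_all add: rc_cnj_real_def rc_re_real_def power2_eq_square)
end

instantiation complex :: real_or_complex
begin
definition rc_cnj_complex :: "complex \<Rightarrow> complex" where "rc_cnj_complex = cnj"
definition rc_re_complex :: "complex \<Rightarrow> real" where "rc_re_complex = Re"
instance
proof
  fix x y :: complex
  show "x * rc_cnj x = (norm x)\<^sup>2 *\<^sub>R 1"
    by (simp add: rc_cnj_complex_def scaleR_conv_of_real flip: complex_norm_square)
qed (simp_all add: rc_cnj_complex_def rc_re_complex_def complex_add_cnj scaleR_conv_of_real)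
end

text \<open>Conjugate-linear in the first argument, so that \<open>\<phi> \<phi>\<^sup>* x = \<langle>\<phi>, x\<rangle> \<phi>\<close>.\<close>

definition rc_inner :: "'a::real_or_complex ^ 'd \<Rightarrow> 'a ^ 'd \<Rightarrow> 'a" where
  "rc_inner x y = (\<Sum>i\<in>UNIV. rc_cnj (x $ i) * y $ i)"

definition rc_adjoint :: "'a::real_or_complex ^ 'd ^ 'd \<Rightarrow> 'a ^ 'd ^ 'd" where
  "rc_adjoint A = (\<chi> i j. rc_cnj (A $ j $ i))"

definition unitary_matrix :: "'a::real_or_complex ^ 'd ^ 'd \<Rightarrow> bool" where
  "unitary_matrix U \<longleftrightarrow> rc_adjoint U ** U = mat 1 \<and> U ** rc_adjoint U = mat 1"

definition orth_proj :: "('a::real_or_complex ^ 'd) set \<Rightarrow> 'a ^ 'd ^ 'd" where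
  "orth_proj S = (THE P. \<forall>x. P *v x \<in> S \<and> (\<forall>y\<in>S. rc_inner y (x - P *v x) = 0))"

text \<open>
  The space \<open>S\<close> is a subspace of the coordinate space (all of it if \<open>S = UNIV\<close>), and the
  last clause says that the frame operator acts on \<open>S\<close> as a multiple of the identity.
\<close>

definition etf :: "('a::real_or_complex ^ 'd) set \<Rightarrow> 'j set \<Rightarrow> ('j \<Rightarrow> 'a ^ 'd) \<Rightarrow> bool" where
  "etf S J \<phi> \<longleftrightarrow>
     finite J \<and>
     vec.span (\<phi> ` J) = S \<and>
     (\<exists>r. \<forall>j\<in>J. norm (\<phi> j) = r) \<and>
     (\<exists>c. \<forall>j\<in>J. \<forall>l\<in>J. j \<noteq> l \<longrightarrow> norm (rc_inner (\<phi> j) (\<phi> l)) = c) \<and>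
     (\<exists>a. \<forall>x\<in>S. (\<Sum>j\<in>J. rc_inner (\<phi> j) x *s \<phi> j) = a *s x)"

definition switching_equivalent ::
    "'j set \<Rightarrow> ('j \<Rightarrow> 'a::real_or_complex ^ 'd) \<Rightarrow> ('j \<Rightarrow> 'a ^ 'd) \<Rightarrow> bool" where
  "switching_equivalent J \<phi> \<psi> \<longleftrightarrow>
     (\<exists>U \<sigma> D. unitary_matrix U \<and> \<sigma> permutes J \<and> (\<forall>j\<in>J. norm (D j) = 1) \<and>
        (\<forall>j\<in>J. \<psi> j = D j *s (U *v \<phi> (\<sigma> j))))"

text \<open>
  The condition on the dimension is written without subtraction, so that the empty set,
  which would need dimension \<open>-1\<close>, is not a simplex.
\<close>

definition is_simplex :: "('j \<Rightarrow> 'a::real_or_complex ^ 'd) \<Rightarrow> 'j set \<Rightarrow> bool" where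
  "is_simplex \<phi> \<beta> \<longleftrightarrow>
     (\<exists>S \<psi>. vec.subspace S \<and> vec.dim S + 1 = card \<beta> \<and> etf S \<beta> \<psi> \<and>
        switching_equivalent \<beta> \<phi> \<psi> \<and>
        (\<forall>i\<in>\<beta>. \<forall>j\<in>\<beta>. i \<noteq> j \<longrightarrow> (\<exists>r<0. rc_inner (\<psi> i) (\<psi> j) = of_real r)))"

definition simplex_binder :: "'j set \<Rightarrow> ('j \<Rightarrow> 'a::real_or_complex ^ 'd) \<Rightarrow> 'j set set" where
  "simplex_binder J \<phi> = {\<beta>. \<beta> \<subseteq> J \<and> is_simplex \<phi> \<beta>}"

text \<open>Blocks form a set rather than a multiset: designs are simple by construction.\<close>

definition simple_bibd :: "'j set \<Rightarrow> 'j set set \<Rightarrow> nat \<Rightarrow> nat \<Rightarrow> nat \<Rightarrow> bool" where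
  "simple_bibd V B v k lam \<longleftrightarrow>
     finite V \<and> card V = v \<and>
     (\<forall>b\<in>B. b \<subseteq> V \<and> card b = k) \<and>
     (\<forall>x\<in>V. \<forall>y\<in>V. x \<noteq> y \<longrightarrow> card {b\<in>B. x \<in> b \<and> y \<in> b} = lam)"

definition affine_design :: "'j set \<Rightarrow> 'j set set \<Rightarrow> bool" where
  "affine_design V B \<longleftrightarrow>
     (\<exists>\<P> \<mu>. partition_on B \<P> \<and> (\<forall>C\<in>\<P>. partition_on V C) \<and>
        (\<forall>C\<in>\<P>. \<forall>C'\<in>\<P>. C \<noteq> C' \<longrightarrow> (\<forall>b\<in>C. \<forall>b'\<in>C'. card (b \<inter> b') = \<mu>)))"

end

theory Submission
  imports Defs
begin

text \<open>
  Applying the frame operator of a simplex of \<open>k\<close> vectors to one of its members, whose inner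
  products with the others are all \<open>-c\<close>, shows that the vectors sum to zero; hence
  \<open>c = r\<^sup>2 / (k - 1)\<close> and the frame bound is \<open>r\<^sup>2 k / (k - 1)\<close>. So \<open>P\<^sub>\<beta>\<close> is an explicit multiple of
  the frame operator of \<open>\<beta>\<close>, and every trace becomes a sum of squared inner products that depends
  only on \<open>m = card (\<beta> \<inter> \<beta>')\<close>: \<open>tr (P\<^sub>\<beta> P\<^sub>\<beta>') = 1 + m (k - 2) / k\<close>. The traces of the frame operator
  of the whole frame and of its square yield the Welch identity and with it the value of \<open>d\<close>. In
  an affine design \<open>m \<in> {0, k\<^sup>2 / v}\<close> for distinct blocks, and \<open>m = k\<^sup>2 / v\<close> gives exactly
  \<open>tr (W\<^sub>\<beta> W\<^sub>\<beta>') = 1 / d\<close>.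
\<close>

subsection \<open>Block designs\<close>

lemma card_off_diagonal:
  assumes "finite A"
  shows "card {p \<in> A \<times> A. fst p \<noteq> snd p} = card A * (card A - 1)"
proof -
  have "{p \<in> A \<times> A. fst p \<noteq> snd p} = A \<times> A - (\<lambda>x. (x, x)) ` A"
    by auto
  moreover have "card ((\<lambda>x. (x, x)) ` A) = card A"
    by (rule card_image) (simp add: inj_on_def)
  moreover have "(\<lambda>x. (x, x)) ` A \<subseteq> A \<times> A"
    by auto
  ultimately show ?thesis
    using assms by (simp add: card_Diff_subset card_cartesian_product diff_mult_distrib2)
qed

lemma simple_bibd_finite:
  assumes "simple_bibd V B v k lam"
  shows "finite B"
  using assms unfolding simple_bibd_def by (intro finite_subset[of B "Pow V"]) auto

text \<open>Double counting of the triples formed by a block and an ordered pair of distinct points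
  in it. The product form avoids a division in \<open>nat\<close>.\<close>

lemma simple_bibd_card_blocks:
  assumes "simple_bibd V B v k lam"
  shows "card B * (k * (k - 1)) = v * (v - 1) * lam"
proof -
  let ?O = "\<lambda>A. {p \<in> A \<times> A. fst p \<noteq> snd p}"
  have V: "finite V" "card V = v" and blocks: "\<And>b. b \<in> B \<Longrightarrow> b \<subseteq> V \<and> card b = k"
    and pairs: "\<And>x y. x \<in> V \<Longrightarrow> y \<in> V \<Longrightarrow> x \<noteq> y \<Longrightarrow> card {b \<in> B. x \<in> b \<and> y \<in> b} = lam"
    using assms unfolding simple_bibd_def by auto
  have "(\<Sum>b\<in>B. card {p \<in> ?O V. fst p \<in> b \<and> snd p \<in> b}) = (\<Sum>p\<in>?O V. lam)"
    by (rule sum_multicount_gen) (use V pairs simple_bibd_finite[OF assms] in auto)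
  also have "\<dots> = v * (v - 1) * lam"
    using V by (simp add: card_off_diagonal)
  also have "(\<Sum>b\<in>B. card {p \<in> ?O V. fst p \<in> b \<and> snd p \<in> b}) = (\<Sum>b\<in>B. k * (k - 1))"
  proof (rule sum.cong[OF refl])
    fix b assume b: "b \<in> B"
    have "{p \<in> ?O V. fst p \<in> b \<and> snd p \<in> b} = ?O b"
      using blocks[OF b] by auto
    moreover have "finite b"
      using blocks[OF b] V finite_subset by blast
    ultimately show "card {p \<in> ?O V. fst p \<in> b \<and> snd p \<in> b} = k * (k - 1)"
      using blocks[OF b] by (simp only: card_off_diagonal)
  qed
  finally show ?thesis by simp
qed

text \<open>Blocks of one parallel class are disjoint. A class has \<open>v / k\<close> blocks and
  cuts each block of another class into pieces of size \<open>\<mu>\<close>, so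
  \<open>\<mu> = k\<^sup>2 / v\<close>; the statement clears this denominator.\<close>

lemma affine_design_intersections:
  assumes "simple_bibd V B v k lam" "affine_design V B" "k > 0" "lam > 0" "k < v"
  obtains b b' where "b \<in> B" "b' \<in> B" "b \<noteq> b'" "card (b \<inter> b') * v = k\<^sup>2"
    and "\<And>c c'. c \<in> B \<Longrightarrow> c' \<in> B \<Longrightarrow> c \<noteq> c' \<Longrightarrow> card (c \<inter> c') * v \<le> k\<^sup>2"
proof -
  have V: "finite V" "card V = v" and blocks: "\<And>b. b \<in> B \<Longrightarrow> b \<subseteq> V \<and> card b = k"
    and pairs: "\<And>x y. x \<in> V \<Longrightarrow> y \<in> V \<Longrightarrow> x \<noteq> y \<Longrightarrow> card {b \<in> B. x \<in> b \<and> y \<in> b} = lam"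
    using assms(1) unfolding simple_bibd_def by auto
  obtain \<P> \<mu> where part: "partition_on B \<P>" and "\<forall>C\<in>\<P>. partition_on V C"
    and "\<forall>C\<in>\<P>. \<forall>C'\<in>\<P>. C \<noteq> C' \<longrightarrow> (\<forall>b\<in>C. \<forall>b'\<in>C'. card (b \<inter> b') = \<mu>)"
    using assms(2) unfolding affine_design_def by (elim exE conjE) (rule that)
  then have classes: "\<And>C. C \<in> \<P> \<Longrightarrow> partition_on V C"
    and \<mu>: "\<And>C C' b b'. C \<in> \<P> \<Longrightarrow> C' \<in> \<P> \<Longrightarrow> C \<noteq> C' \<Longrightarrow> b \<in> C \<Longrightarrow> b' \<in> C' \<Longrightarrow> card (b \<inter> b') = \<mu>"
    by simp_all
  have join: "\<exists>b\<in>B. x \<in> b \<and> y \<in> b" if "x \<in> V" "y \<in> V" "x \<noteq> y" for x y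
  proof -
    have "{b \<in> B. x \<in> b \<and> y \<in> b} \<noteq> {}"
      using pairs[OF that] \<open>lam > 0\<close> by (metis card.empty less_irrefl)
    then show ?thesis by blast
  qed
  have B_eq: "B = \<Union>\<P>"
    using part by (simp add: partition_on_def)
  have meet: "card (b \<inter> b') * v = k\<^sup>2"
    if C: "C \<in> \<P>" "C' \<in> \<P>" "C \<noteq> C'" "b \<in> C" "b' \<in> C'" for C C' b b'
  proof -
    have p: "partition_on V C'" using classes[OF C(2)] .
    have fin: "finite C'" using p V finite_elements by blast
    have sub: "c \<in> B" if "c \<in> C'" for c using that C B_eq by blast
    have finb: "finite c" if "c \<in> C'" for c
      using blocks[OF sub[OF that]] V finite_subset by blast
    have "v = card (\<Union>C')" using p V by (simp add: partition_on_def)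
    also have "\<dots> = (\<Sum>c\<in>C'. card c)"
      using p finb by (intro card_Union_disjoint) (auto simp: partition_on_def disjoint_def pairwise_def disjnt_def)
    also have "\<dots> = (\<Sum>c\<in>C'. k)"
      using blocks sub by (intro sum.cong) auto
    finally have v: "v = card C' * k" by simp
    have b: "b \<in> B" using C B_eq by blast
    have "(\<Union>c\<in>C'. b \<inter> c) = b"
      using blocks[OF b] unfolding partition_onD1[OF p] by blast
    then have "k = card (\<Union>c\<in>C'. b \<inter> c)" using blocks[OF b] by simp
    also have "\<dots> = (\<Sum>c\<in>C'. card (b \<inter> c))"
      using p finb fin
      by (intro card_UN_disjoint) (auto simp: partition_on_def disjoint_def)
    also have "\<dots> = (\<Sum>c\<in>C'. \<mu>)"
      using \<mu>[OF C(1-4)] by (intro sum.cong) auto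
    finally have k: "k = card C' * \<mu>" by simp
    have "card (b \<inter> b') = \<mu>" using \<mu>[OF C] .
    then have "card (b \<inter> b') * v = \<mu> * card C' * k" using v by simp
    also have "\<dots> = k * k" using k by (simp add: mult.commute)
    finally show ?thesis by (simp add: power2_eq_square)
  qed
  have same: "card (b \<inter> b') = 0" if "C \<in> \<P>" "b \<in> C" "b' \<in> C" "b \<noteq> b'" for C b b'
    using classes[OF that(1)] that unfolding partition_on_def disjoint_def by simp
  have bound: "card (c \<inter> c') * v \<le> k\<^sup>2" if cc: "c \<in> B" "c' \<in> B" "c \<noteq> c'" for c c'
  proof -
    obtain C C' where C: "C \<in> \<P>" "C' \<in> \<P>" "c \<in> C" "c' \<in> C'" using cc B_eq by blast
    show ?thesis
    proof (cases "C = C'")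
      case True
      then show ?thesis using same[of C c c'] C cc by simp
    next
      case False
      then show ?thesis using meet[of C C' c c'] C by simp
    qed
  qed
  have "1 < card V" using V assms by simp
  then obtain x y where xy: "x \<in> V" "y \<in> V" "x \<noteq> y"
    using V(1) card_le_Suc0_iff_eq[of V] by auto
  obtain b where b: "b \<in> B" using join[OF xy] by blast
  obtain C where C: "C \<in> \<P>" "b \<in> C" using b B_eq by blast
  \<comment> \<open>A block through some \<open>w \<in> b\<close> and some
    \<open>z \<notin> b\<close> meets \<open>b\<close> and differs from it, so it must lie in
    another parallel class.\<close>
  have "card b < card V" using blocks[OF b] assms V by simp
  then have "\<not> V \<subseteq> b"
    using blocks[OF b] by auto
  then obtain z where z: "z \<in> V" "z \<notin> b" by blast
  have "b \<noteq> {}" using blocks[OF b] assms by auto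
  then obtain w where w: "w \<in> b" by blast
  obtain b' where b': "b' \<in> B" "w \<in> b'" "z \<in> b'"
    using join[of w z] w z blocks[OF b] by blast
  obtain C' where C': "C' \<in> \<P>" "b' \<in> C'" using b' B_eq by blast
  have ne: "b \<noteq> b'" using z b' by blast
  have "finite b" using blocks[OF b] V finite_subset by blast
  then have "card (b \<inter> b') \<noteq> 0" using w b' by auto
  then have "C \<noteq> C'" using same[of C b b'] C C' ne by blast
  then have "card (b \<inter> b') * v = k\<^sup>2"
    using meet[of C C' b b'] C C' by simp
  with b b'(1) ne show ?thesis
    by (rule that) (rule bound)
qed

subsection \<open>Scalars and inner products\<close>

lemma rc_cnj_0 [simp]: "rc_cnj (0::'a::real_or_complex) = 0"
  using rc_cnj_add[of 0 "0::'a"] by simp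

text \<open>For a nonzero real \<open>x\<close>, \<open>rc_mult_cnj\<close> reads
  \<open>x * rc_cnj x = x * x\<close>, and \<open>x\<close> cancels.\<close>

lemma rc_cnj_of_real [simp]: "rc_cnj (of_real r :: 'a::real_or_complex) = of_real r"
proof (cases "r = 0")
  case False
  have "of_real r * rc_cnj (of_real r :: 'a) = of_real r * of_real r"
    using rc_mult_cnj[of "of_real r :: 'a"] by (simp add: scaleR_conv_of_real power2_eq_square)
  then show ?thesis using False by simp
qed simp

lemma rc_re_of_real [simp]: "rc_re (of_real r :: 'a::real_or_complex) = r"
proof -
  have "of_real (2 * rc_re (of_real r :: 'a)) = (of_real (2 * r) :: 'a)"
    using rc_add_cnj[of "of_real r :: 'a"] by (simp add: scaleR_conv_of_real)
  then show ?thesis by (simp only: of_real_eq_iff)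
qed

lemma rc_cnj_sum: "rc_cnj (sum f A) = (\<Sum>x\<in>A. rc_cnj (f x :: 'a::real_or_complex))"
  by (induction A rule: infinite_finite_induct) (simp_all add: rc_cnj_add)

lemma mult_rc_cnj: "x * rc_cnj x = of_real ((norm x)\<^sup>2)" for x :: "'a::real_or_complex"
  by (simp add: rc_mult_cnj scaleR_conv_of_real)

lemma norm_rc_cnj: "norm (rc_cnj x) = norm x" for x :: "'a::real_or_complex"
proof (cases "x = 0")
  case False
  have "norm x * norm (rc_cnj x) = norm x * norm x"
    by (simp add: norm_mult[symmetric] mult_rc_cnj) (simp add: power2_eq_square norm_mult)
  then show ?thesis using False by simp
qed simp

lemma rc_inner_add_right: "rc_inner x (y + z) = rc_inner x y + rc_inner x z"
  by (simp add: rc_inner_def distrib_left sum.distrib)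

lemma rc_inner_diff_right: "rc_inner x (y - z) = rc_inner x y - rc_inner x z"
  by (simp add: rc_inner_def right_diff_distrib sum_subtractf)

lemma rc_inner_mult_right: "rc_inner x (c *s y) = c * rc_inner x y"
  by (simp add: rc_inner_def sum_distrib_left ac_simps)

lemma rc_cnj_inner: "rc_cnj (rc_inner x y) = rc_inner y x"
  by (simp add: rc_inner_def rc_cnj_sum rc_cnj_mult rc_cnj_cnj mult.commute)

lemma rc_inner_add_left: "rc_inner (x + y) z = rc_inner x z + rc_inner y z"
  by (simp add: rc_inner_def rc_cnj_add distrib_right sum.distrib)

lemma rc_inner_mult_left: "rc_inner (c *s x) y = rc_cnj c * rc_inner x y"
  by (simp add: rc_inner_def rc_cnj_mult sum_distrib_left ac_simps)

lemma rc_inner_0_left [simp]: "rc_inner 0 y = 0"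
  by (simp add: rc_inner_def)

lemma rc_inner_0_right [simp]: "rc_inner x 0 = 0"
  by (simp add: rc_inner_def)

lemma rc_inner_sum_right: "rc_inner x (sum f A) = (\<Sum>j\<in>A. rc_inner x (f j))"
  by (induction A rule: infinite_finite_induct) (simp_all add: rc_inner_add_right)

lemma rc_inner_sum_left: "rc_inner (sum f A) y = (\<Sum>j\<in>A. rc_inner (f j) y)"
  by (induction A rule: infinite_finite_induct) (simp_all add: rc_inner_add_left)

lemma rc_inner_self: "rc_inner x x = of_real ((norm x)\<^sup>2)"
proof -
  have "rc_inner x x = (\<Sum>i\<in>UNIV. of_real ((norm (x $ i))\<^sup>2))"
    by (simp only: rc_inner_def mult_rc_cnj[symmetric] mult.commute)
  also have "\<dots> = of_real ((norm x)\<^sup>2)"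
    by (simp add: norm_vec_def L2_set_def sum_nonneg)
  finally show ?thesis .
qed

lemma rc_inner_mult_swap: "rc_inner x y * rc_inner y x = of_real ((norm (rc_inner x y))\<^sup>2)"
  using mult_rc_cnj[of "rc_inner x y"] by (simp add: rc_cnj_inner)

lemma rc_inner_matrix_left: "rc_inner (A *v x) y = rc_inner x (rc_adjoint A *v y)"
proof -
  have "rc_inner (A *v x) y = (\<Sum>i\<in>UNIV. \<Sum>j\<in>UNIV. rc_cnj (A $ i $ j) * rc_cnj (x $ j) * y $ i)"
    by (simp add: rc_inner_def matrix_vector_mult_def rc_cnj_sum rc_cnj_mult sum_distrib_right)
  also have "\<dots> = (\<Sum>j\<in>UNIV. \<Sum>i\<in>UNIV. rc_cnj (A $ i $ j) * rc_cnj (x $ j) * y $ i)"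
    by (rule sum.swap)
  also have "\<dots> = rc_inner x (rc_adjoint A *v y)"
    by (simp add: rc_inner_def matrix_vector_mult_def rc_adjoint_def sum_distrib_left ac_simps)
  finally show ?thesis .
qed

lemma rc_inner_unitary:
  assumes "unitary_matrix U"
  shows "rc_inner (U *v x) (U *v y) = rc_inner x y"
  using assms
  by (simp add: rc_inner_matrix_left unitary_matrix_def matrix_vector_mul_assoc)

subsection \<open>Frame operators\<close>

text \<open>The sum of the rank-one matrices \<open>\<phi> j (\<phi> j)^*\<close>, that is, the
  frame operator. The index set is a parameter so that it serves both the whole frame and a single
  block.\<close>

definition frame_matrix :: "'j set \<Rightarrow> ('j \<Rightarrow> 'a::real_or_complex ^ 'd) \<Rightarrow> 'a ^ 'd ^ 'd" where
  "frame_matrix A \<phi> = (\<chi> p q. \<Sum>j\<in>A. \<phi> j $ p * rc_cnj (\<phi> j $ q))"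

lemma frame_matrix_mult_vec: "frame_matrix A \<phi> *v x = (\<Sum>j\<in>A. rc_inner (\<phi> j) x *s \<phi> j)"
proof -
  have "(\<Sum>q\<in>UNIV. (\<Sum>j\<in>A. \<phi> j $ p * rc_cnj (\<phi> j $ q)) * x $ q)
      = (\<Sum>j\<in>A. (\<Sum>q\<in>UNIV. rc_cnj (\<phi> j $ q) * x $ q) * \<phi> j $ p)" for p
    unfolding sum_distrib_right by (subst sum.swap) (simp add: ac_simps)
  then show ?thesis
    by (simp add: vec_eq_iff frame_matrix_def matrix_vector_mult_def rc_inner_def)
qed

lemma trace_frame_matrix: "trace (frame_matrix A \<phi>) = (\<Sum>j\<in>A. of_real ((norm (\<phi> j))\<^sup>2))"
proof -
  have "trace (frame_matrix A \<phi>) = (\<Sum>j\<in>A. rc_inner (\<phi> j) (\<phi> j))"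
    unfolding trace_def frame_matrix_def rc_inner_def
    by (simp, subst sum.swap) (simp add: mult.commute)
  then show ?thesis by (simp add: rc_inner_self)
qed

text \<open>By bilinearity this reduces to rank-one factors, where \<open>x x^* y y^*\<close> has
  trace equal to the squared modulus of \<open>rc_inner x y\<close>.\<close>

lemma trace_frame_matrix_mult:
  fixes \<phi> :: "'j \<Rightarrow> 'a::real_or_complex ^ 'd"
  shows "trace (frame_matrix A \<phi> ** frame_matrix A' \<phi>)
    = of_real (\<Sum>j\<in>A. \<Sum>l\<in>A'. (norm (rc_inner (\<phi> j) (\<phi> l)))\<^sup>2)"
proof -
  have swap: "rc_inner (\<phi> l) (\<phi> j) * rc_inner (\<phi> j) (\<phi> l) = of_real ((norm (rc_inner (\<phi> j) (\<phi> l)))\<^sup>2)"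
    for j l
    by (metis mult.commute rc_inner_mult_swap)
  have "trace (frame_matrix A \<phi> ** frame_matrix A' \<phi>)
      = (\<Sum>p\<in>UNIV. \<Sum>q\<in>UNIV. \<Sum>j\<in>A. \<Sum>l\<in>A'.
          (\<phi> j $ p * rc_cnj (\<phi> j $ q)) * (\<phi> l $ q * rc_cnj (\<phi> l $ p)))"
    by (simp add: trace_def frame_matrix_def matrix_matrix_mult_def sum_product)
  also have "\<dots> = (\<Sum>j\<in>A. \<Sum>l\<in>A'. \<Sum>p\<in>UNIV. \<Sum>q\<in>UNIV.
          (\<phi> j $ p * rc_cnj (\<phi> j $ q)) * (\<phi> l $ q * rc_cnj (\<phi> l $ p)))"
    by (simp only: sum.swap[of _ A UNIV] sum.swap[of _ A' UNIV])
  also have "\<dots> = (\<Sum>j\<in>A. \<Sum>l\<in>A'. rc_inner (\<phi> l) (\<phi> j) * rc_inner (\<phi> j) (\<phi> l))"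
    by (simp add: rc_inner_def sum_product ac_simps)
  also have "\<dots> = of_real (\<Sum>j\<in>A. \<Sum>l\<in>A'. (norm (rc_inner (\<phi> j) (\<phi> l)))\<^sup>2)"
    by (simp only: swap of_real_sum)
  finally show ?thesis .
qed

text \<open>\<open>orth_proj\<close> is a definite description, so uniqueness is required: for two
  candidates \<open>P\<close> and \<open>Q\<close>, the vector \<open>Q *v x - P *v x\<close> lies
  in \<open>S\<close> and is orthogonal to itself.\<close>

lemma orth_proj_eqI:
  fixes P :: "'a::real_or_complex ^ 'd ^ 'd"
  assumes S: "vec.subspace S"
    and P: "\<And>x. P *v x \<in> S" "\<And>x y. y \<in> S \<Longrightarrow> rc_inner y (x - P *v x) = 0"
  shows "orth_proj S = P"
  unfolding orth_proj_def
proof (rule the_equality)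
  fix Q :: "'a ^ 'd ^ 'd"
  assume Q: "\<forall>x. Q *v x \<in> S \<and> (\<forall>y\<in>S. rc_inner y (x - Q *v x) = 0)"
  have "Q *v x = P *v x" for x
  proof -
    let ?y = "Q *v x - P *v x"
    have "?y \<in> S" using S Q P by (simp add: vec.subspace_diff)
    then have "rc_inner ?y (x - P *v x) - rc_inner ?y (x - Q *v x) = 0"
      using Q P by simp
    then have "rc_inner ?y ?y = 0"
      by (simp add: rc_inner_diff_right)
    then show ?thesis by (simp add: rc_inner_self)
  qed
  then show "Q = P" by (simp add: matrix_eq)
qed (use P in blast)

text \<open>The frame matrix is self-adjoint, so its eigenvector equation at \<open>\<phi> i\<close>
  makes the residual of any \<open>x\<close> orthogonal to \<open>\<phi> i\<close>. Orthogonality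
  then extends to the span by linearity.\<close>

lemma orth_proj_tight_frame:
  fixes \<phi> :: "'j \<Rightarrow> 'a::real_or_complex ^ 'd"
  assumes "a \<noteq> 0"
    and tight: "\<And>i. i \<in> A \<Longrightarrow> frame_matrix A \<phi> *v \<phi> i = of_real a *s \<phi> i"
  shows "orth_proj (vec.span (\<phi> ` A)) = frame_matrix A \<phi> /\<^sub>R a"
proof (rule orth_proj_eqI)
  let ?F = "frame_matrix A \<phi>"
  have F: "(?F /\<^sub>R a) *v x = of_real (inverse a) *s (?F *v x)" for x
    by (simp add: vec_eq_iff matrix_vector_mult_def sum_distrib_left
        scaleR_conv_of_real[where 'a='a] ac_simps)
  show "(?F /\<^sub>R a) *v x \<in> vec.span (\<phi> ` A)" for x
    unfolding F frame_matrix_mult_vec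
    by (intro vec.span_scale vec.span_sum vec.span_base imageI)
  show "rc_inner y (x - (?F /\<^sub>R a) *v x) = 0" if "y \<in> vec.span (\<phi> ` A)" for x y
    using that
  proof (induction rule: vec.span_induct_alt)
    case (step c z y)
    then obtain i where i: "i \<in> A" "z = \<phi> i" by blast
    have "rc_inner (\<phi> i) (?F *v x) = rc_inner (?F *v \<phi> i) x"
      by (simp add: frame_matrix_mult_vec rc_inner_sum_left rc_inner_sum_right
          rc_inner_mult_left rc_inner_mult_right rc_cnj_inner mult.commute)
    also have "\<dots> = of_real a * rc_inner (\<phi> i) x"
      by (simp add: tight[OF i(1)] rc_inner_mult_left)
    finally have "rc_inner z (x - (?F /\<^sub>R a) *v x) = 0"
      using \<open>a \<noteq> 0\<close> i by (simp add: F rc_inner_diff_right rc_inner_mult_right)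
    then show ?case
      using step by (simp add: rc_inner_add_left rc_inner_mult_left)
  qed simp
qed simp

subsection \<open>Equiangular tight frames and simplices\<close>

text \<open>A pair \<open>j = l\<close> contributes \<open>r ^ 4\<close> and any other pair
  \<open>c\<^sup>2\<close>. The case \<open>A = A'\<close> gives the trace of a squared frame
  operator, two blocks give a mixed trace.\<close>

lemma equiangular_sum:
  fixes \<phi> :: "'j \<Rightarrow> 'a::real_or_complex ^ 'd"
  assumes "finite A" "finite A'"
    and r: "\<And>j. j \<in> A \<Longrightarrow> norm (\<phi> j) = r"
    and c: "\<And>j l. j \<in> A \<Longrightarrow> l \<in> A' \<Longrightarrow> j \<noteq> l \<Longrightarrow> norm (rc_inner (\<phi> j) (\<phi> l)) = c"
  shows "(\<Sum>j\<in>A. \<Sum>l\<in>A'. (norm (rc_inner (\<phi> j) (\<phi> l)))\<^sup>2)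
    = real (card (A \<inter> A')) * r ^ 4 + (real (card A) * real (card A') - real (card (A \<inter> A'))) * c\<^sup>2"
proof -
  have "(\<Sum>j\<in>A. \<Sum>l\<in>A'. (norm (rc_inner (\<phi> j) (\<phi> l)))\<^sup>2)
      = (\<Sum>j\<in>A. \<Sum>l\<in>A'. c\<^sup>2 + (if j = l then r ^ 4 - c\<^sup>2 else 0))"
    by (intro sum.cong refl) (auto simp: r[symmetric] c rc_inner_self power2_eq_square power4_eq_xxxx norm_mult)
  also have "\<dots> = real (card A) * real (card A') * c\<^sup>2 + (\<Sum>j\<in>A. if j \<in> A' then r ^ 4 - c\<^sup>2 else 0)"
    using assms by (simp add: sum.distrib)
  also have "(\<Sum>j\<in>A. if j \<in> A' then r ^ 4 - c\<^sup>2 else 0) = real (card (A \<inter> A')) * (r ^ 4 - c\<^sup>2)"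
    using assms by (simp add: sum.If_cases Int_def)
  finally show ?thesis by (simp add: algebra_simps)
qed

text \<open>With \<open>n = card J\<close>, the frame operator is \<open>a\<close> times the
  identity. Its trace gives \<open>n * r\<^sup>2 = d * a\<close>, the trace of its square gives a
  second equation, and eliminating \<open>a\<close> leaves the identity.\<close>

lemma etf_welch:
  fixes \<phi> :: "'j \<Rightarrow> 'a::real_or_complex ^ 'd"
  assumes span: "vec.span (\<phi> ` J) = UNIV" and "finite J"
    and r: "\<And>j. j \<in> J \<Longrightarrow> norm (\<phi> j) = r"
    and c: "\<And>j l. j \<in> J \<Longrightarrow> l \<in> J \<Longrightarrow> j \<noteq> l \<Longrightarrow> norm (rc_inner (\<phi> j) (\<phi> l)) = c"
    and a: "\<And>x. (\<Sum>j\<in>J. rc_inner (\<phi> j) x *s \<phi> j) = a *s x"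
  shows "r \<noteq> 0" "card J > 0"
    and "real CARD('d) * (r ^ 4 + (real (card J) - 1) * c\<^sup>2) = real (card J) * r ^ 4"
proof -
  \<comment> \<open>The span contains the axis vectors, which are nonzero, so some member of the
    frame is nonzero.\<close>
  have "\<not> \<phi> ` J \<subseteq> {0}"
  proof
    assume "\<phi> ` J \<subseteq> {0}"
    then have "vec.span (\<phi> ` J) \<subseteq> {0}"
      by (rule vec.span_minimal) simp
    then have "(axis i 1 :: 'a ^ 'd) = 0" for i
      unfolding span by blast
    then show False by (metis axis_eq_0_iff one_neq_zero)
  qed
  then obtain i where i: "i \<in> J" "\<phi> i \<noteq> 0" by blast
  then show r0: "r \<noteq> 0" using r by fastforce
  show v0: "card J > 0" using i \<open>finite J\<close> card_gt_0_iff by blast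
  let ?n = "real (card J)" and ?d = "real CARD('d)" and ?F = "frame_matrix J \<phi>"
  have delta: "(if p then u else 0) * w = (if p then u * w else 0)" for p and u w :: 'a
    by simp
  have F: "?F = mat a"
    unfolding matrix_eq frame_matrix_mult_vec a
    by (simp add: vec_eq_iff matrix_vector_mult_def mat_def delta)
  have "of_real (?n * r\<^sup>2) = trace ?F"
    by (simp add: trace_frame_matrix r)
  also have "\<dots> = of_real ?d * a"
    by (simp add: F trace_def mat_def)
  finally have 1: "of_real (?n * r\<^sup>2) = of_real ?d * a" .
  have "of_real (?n * r ^ 4 + (?n * ?n - ?n) * c\<^sup>2) = trace (?F ** ?F)"
    using trace_frame_matrix_mult[of J \<phi> J] equiangular_sum[OF \<open>finite J\<close> \<open>finite J\<close>, of \<phi> r c] r c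
    by simp
  also have "?F ** ?F = mat (a * a)"
    by (simp add: F vec_eq_iff matrix_matrix_mult_def mat_def delta)
  also have "trace (mat (a * a) :: 'a ^ 'd ^ 'd) = of_real ?d * (a * a)"
    by (simp add: trace_def mat_def)
  \<comment> \<open>The bound \<open>a\<close> is an element of \<open>'a\<close> about which
    reality is not assumed. Scaling by \<open>?d\<close> turns \<open>a\<close> into
    \<open>of_real ?d * a\<close>, already known to be real, and injectivity of
    \<open>of_real\<close> then yields a real equation.\<close>
  finally have "of_real (?d * (?n * r ^ 4 + (?n * ?n - ?n) * c\<^sup>2)) = (of_real ?d * a) * (of_real ?d * a)"
    by simp
  also have "\<dots> = of_real ((?n * r\<^sup>2) * (?n * r\<^sup>2))"
    by (simp only: 1[symmetric] of_real_mult)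
  finally have "?d * (?n * r ^ 4 + (?n * ?n - ?n) * c\<^sup>2) = (?n * r\<^sup>2) * (?n * r\<^sup>2)"
    by (simp only: of_real_eq_iff)
  then have "?n * (?d * (r ^ 4 + (?n - 1) * c\<^sup>2)) = ?n * (?n * r ^ 4)"
    by (simp add: algebra_simps power2_eq_square power4_eq_xxxx)
  then show "?d * (r ^ 4 + (?n - 1) * c\<^sup>2) = ?n * r ^ 4"
    using v0 by simp
qed

lemma matrix_vector_mult_sum: "A *v sum f S = (\<Sum>j\<in>S. A *v f j)"
  for A :: "'a::field ^ 'n ^ 'm"
  by (induction S rule: infinite_finite_induct) (simp_all add: matrix_vector_right_distrib)

text \<open>The simplex condition concerns a switched copy \<open>\<psi>\<close>, while
  \<open>r\<close> and \<open>c\<close> belong to \<open>\<phi>\<close>. Switching permutes the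
  moduli of the Gram entries and conjugates the frame operator by \<open>U\<close>, so what is
  proved for \<open>\<psi>\<close> returns to \<open>\<phi>\<close>.\<close>

lemma simplex_frame:
  fixes \<phi> :: "'j \<Rightarrow> 'a::real_or_complex ^ 'd"
  assumes simplex: "is_simplex \<phi> \<beta>" and card: "card \<beta> \<ge> 2"
    and r: "\<And>j. j \<in> \<beta> \<Longrightarrow> norm (\<phi> j) = r"
    and c: "\<And>j l. j \<in> \<beta> \<Longrightarrow> l \<in> \<beta> \<Longrightarrow> j \<noteq> l \<Longrightarrow> norm (rc_inner (\<phi> j) (\<phi> l)) = c"
  shows "(real (card \<beta>) - 1) * c = r\<^sup>2"
    and "\<And>i. i \<in> \<beta> \<Longrightarrow> frame_matrix \<beta> \<phi> *v \<phi> i = of_real (r\<^sup>2 + c) *s \<phi> i"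
proof -
  have fin: "finite \<beta>" using card by (metis card.infinite not_numeral_le_zero)
  obtain S \<psi> where S: "etf S \<beta> \<psi>" and sw: "switching_equivalent \<beta> \<phi> \<psi>"
    and neg: "\<And>i j. i \<in> \<beta> \<Longrightarrow> j \<in> \<beta> \<Longrightarrow> i \<noteq> j \<Longrightarrow> \<exists>s<0. rc_inner (\<psi> i) (\<psi> j) = of_real s"
    using simplex unfolding is_simplex_def by blast
  obtain U \<sigma> D where U: "unitary_matrix U" and \<sigma>: "\<sigma> permutes \<beta>"
    and D: "\<And>j. j \<in> \<beta> \<Longrightarrow> norm (D j) = 1"
    and \<psi>: "\<And>j. j \<in> \<beta> \<Longrightarrow> \<psi> j = D j *s (U *v \<phi> (\<sigma> j))"
    using sw unfolding switching_equivalent_def by blast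
  obtain a where span: "vec.span (\<psi> ` \<beta>) = S"
    and a: "\<And>x. x \<in> S \<Longrightarrow> (\<Sum>j\<in>\<beta>. rc_inner (\<psi> j) x *s \<psi> j) = a *s x"
    using S unfolding etf_def by blast
  have DD: "D j * rc_cnj (D j) = 1" if "j \<in> \<beta>" for j
    using D[OF that] by (simp add: mult_rc_cnj)
  have gram: "rc_inner (\<psi> i) (\<psi> j) = rc_cnj (D i) * D j * rc_inner (\<phi> (\<sigma> i)) (\<phi> (\<sigma> j))"
    if "i \<in> \<beta>" "j \<in> \<beta>" for i j
    using that by (simp add: \<psi> rc_inner_mult_left rc_inner_mult_right rc_inner_unitary[OF U])
  have \<sigma>_in: "\<sigma> i \<in> \<beta>" if "i \<in> \<beta>" for i
    using \<sigma> that by (simp add: permutes_in_image)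
  have diag: "rc_inner (\<psi> i) (\<psi> i) = of_real (r\<^sup>2)" if "i \<in> \<beta>" for i
    using gram[OF that that] DD[OF that] r[OF \<sigma>_in[OF that]]
    by (simp add: rc_inner_self mult.commute)
  \<comment> \<open>Equiangularity gives the modulus \<open>c\<close>, and the simplex condition
    gives the negative sign.\<close>
  have offd: "rc_inner (\<psi> i) (\<psi> j) = - of_real c \<and> c > 0"
    if ij: "i \<in> \<beta>" "j \<in> \<beta>" "i \<noteq> j" for i j
  proof -
    obtain s where s: "s < 0" "rc_inner (\<psi> i) (\<psi> j) = of_real s"
      using neg[OF ij] by blast
    have "\<sigma> i \<noteq> \<sigma> j" using \<sigma> that(3) by (metis permutes_inverses(2))
    then have "norm (rc_inner (\<psi> i) (\<psi> j)) = c"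
      using gram[OF that(1,2)] D that c[OF \<sigma>_in[OF that(1)] \<sigma>_in[OF that(2)]]
      by (simp add: norm_mult norm_rc_cnj)
    then have "s = - c" using s by simp
    then show ?thesis using s by simp
  qed
  obtain x y where xy: "x \<in> \<beta>" "y \<in> \<beta>" "x \<noteq> y"
    using card card_le_Suc0_iff_eq[OF fin] by auto
  have c0: "c > 0" using offd[OF xy] by simp
  let ?s = "\<Sum>j\<in>\<beta>. \<psi> j"
  have frame: "(\<Sum>j\<in>\<beta>. rc_inner (\<psi> j) (\<psi> i) *s \<psi> j)
      = of_real (r\<^sup>2 + c) *s \<psi> i - of_real c *s ?s" if "i \<in> \<beta>" for i
  proof -
    \<comment> \<open>The diagonal value is split as \<open>r\<^sup>2 = (r\<^sup>2 + c) - c\<close>,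
      so that every index carries the same coefficient \<open>-c\<close>.\<close>
    have "(\<Sum>j\<in>\<beta>. rc_inner (\<psi> j) (\<psi> i) *s \<psi> j)
      = (\<Sum>j\<in>\<beta>. (if j = i then of_real (r\<^sup>2 + c) *s \<psi> j else 0) - of_real c *s \<psi> j)"
      using that by (intro sum.cong refl)
        (auto simp: diag offd vec_eq_iff algebra_simps)
    then show ?thesis
      using that fin by (simp add: sum_subtractf vec.scale_sum_right)
  qed
  have \<psi>S: "\<psi> i \<in> S" if "i \<in> \<beta>" for i
    using that span vec.span_base by blast
  \<comment> \<open>The vector \<open>\<delta> *s \<psi> i\<close> does not depend on
    \<open>i\<close>. If \<open>\<delta>\<close> were nonzero, all \<open>\<psi> i\<close> would
    coincide, and \<open>r\<^sup>2\<close> would equal the negative number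
    \<open>-c\<close>.\<close>
  define \<delta> where "\<delta> = of_real (r\<^sup>2 + c) - a"
  have \<delta>: "\<delta> *s \<psi> i = of_real c *s ?s" if "i \<in> \<beta>" for i
    using frame[OF that] a[OF \<psi>S[OF that]]
    by (simp add: \<delta>_def algebra_simps)
  have "\<delta> = 0"
  proof (rule ccontr)
    assume "\<delta> \<noteq> 0"
    then have "\<psi> x = \<psi> y" using \<delta>[OF xy(1)] \<delta>[OF xy(2)] by (metis vec.scale_left_imp_eq)
    then have "of_real (r\<^sup>2) = (of_real (- c) :: 'a)"
      using diag[OF xy(1)] offd[OF xy] by simp
    then have "r\<^sup>2 = - c" by (simp only: of_real_eq_iff)
    then show False using c0 zero_le_power2[of r] by linarith
  qed
  then have s0: "?s = 0"
    using \<delta>[OF xy(1)] c0 by simp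
  \<comment> \<open>Pairing the vanishing sum with one member gives
    \<open>r\<^sup>2 + c - card \<beta> * c = 0\<close>.\<close>
  have "rc_inner (\<psi> x) ?s = (\<Sum>j\<in>\<beta>. (if j = x then of_real (r\<^sup>2 + c) else 0) - of_real c)"
    unfolding rc_inner_sum_right
    using xy by (intro sum.cong refl) (auto simp: diag offd)
  then have "of_real (r\<^sup>2 + c - real (card \<beta>) * c) = (of_real 0 :: 'a)"
    using xy fin by (simp add: sum_subtractf s0)
  then have "r\<^sup>2 + c - real (card \<beta>) * c = 0" by (simp only: of_real_eq_iff)
  then show "(real (card \<beta>) - 1) * c = r\<^sup>2"
    by (simp add: algebra_simps)
  \<comment> \<open>Return to \<open>\<phi>\<close>: with \<open>l = \<sigma> i\<close>, applying
    \<open>U\<close> and multiplying by \<open>D i\<close> turns the frame sum of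
    \<open>\<phi>\<close> at \<open>l\<close> into that of \<open>\<psi>\<close> at
    \<open>i\<close>; the phases \<open>D j\<close> cancel against their conjugates.\<close>
  fix l assume "l \<in> \<beta>"
  then obtain i where i: "i \<in> \<beta>" "l = \<sigma> i"
    using \<sigma> by (metis permutes_image imageE)
  let ?g = "\<lambda>j. rc_inner (\<phi> j) (\<phi> l) *s \<phi> j"
  have "D i *s (U *v (frame_matrix \<beta> \<phi> *v \<phi> l)) = (\<Sum>j\<in>\<beta>. D i *s (U *v ?g j))"
    by (simp add: frame_matrix_mult_vec matrix_vector_mult_sum vec.scale_sum_right)
  also have "\<dots> = (\<Sum>j\<in>\<beta>. D i *s (U *v ?g (\<sigma> j)))"
    by (rule sum.permute[OF \<sigma>, unfolded comp_def])
  also have "\<dots> = (\<Sum>j\<in>\<beta>. rc_inner (\<psi> j) (\<psi> i) *s \<psi> j)"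
  proof (rule sum.cong[OF refl])
    fix j assume j: "j \<in> \<beta>"
    have "rc_inner (\<psi> j) (\<psi> i) *s \<psi> j
      = (D j * rc_cnj (D j)) *s (D i *s (rc_inner (\<phi> (\<sigma> j)) (\<phi> (\<sigma> i)) *s (U *v \<phi> (\<sigma> j))))"
      unfolding gram[OF j i(1)] unfolding \<psi>[OF j] by (simp add: ac_simps)
    then show "D i *s (U *v ?g (\<sigma> j)) = rc_inner (\<psi> j) (\<psi> i) *s \<psi> j"
      using DD[OF j] i by (simp add: vector_scalar_commute)
  qed
  also have "\<dots> = D i *s (U *v (of_real (r\<^sup>2 + c) *s \<phi> l))"
    unfolding frame[OF i(1)] s0 using i by (simp add: \<psi> vector_scalar_commute mult.commute del: of_real_add)
  finally have "U *v (frame_matrix \<beta> \<phi> *v \<phi> l) = U *v (of_real (r\<^sup>2 + c) *s \<phi> l)"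
    using D[OF i(1)] by (metis norm_zero vec.scale_left_imp_eq zero_neq_one)
  then have "(rc_adjoint U ** U) *v (frame_matrix \<beta> \<phi> *v \<phi> l)
      = (rc_adjoint U ** U) *v (of_real (r\<^sup>2 + c) *s \<phi> l)"
    by (simp only: matrix_vector_mul_assoc[symmetric])
  then show "frame_matrix \<beta> \<phi> *v \<phi> l = of_real (r\<^sup>2 + c) *s \<phi> l"
    using U by (simp add: unitary_matrix_def)
qed

section \<open>Traces of the block operators and the Rankin bound\<close>

lemma trace_scaleR: "trace (s *\<^sub>R A) = s *\<^sub>R trace A" for A :: "'a::real_normed_field ^ 'n ^ 'n"
  by (simp add: trace_def scaleR_sum_right)

lemma matrix_mult_scaleR: "(s *\<^sub>R A) ** (t *\<^sub>R C) = (s * t) *\<^sub>R (A ** C)"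
  for A C :: "'a::real_normed_field ^ 'n ^ 'n"
  by (simp add: vec_eq_iff matrix_matrix_mult_def scaleR_sum_right mult.commute[of s])

theorem theorem6p3:
  fixes J :: "'j set"
    and \<phi> :: "'j \<Rightarrow> 'a::real_or_complex ^ 'd"
    and B :: "'j set set"
    and v k lam :: nat
    and W :: "'j set \<Rightarrow> 'a ^ 'd ^ 'd"
  assumes "etf UNIV J \<phi>"
    and "B = simplex_binder J \<phi>"
    and "simple_bibd J B v k lam"
    and "affine_design J B"
    and "k \<ge> 2"
    and "lam > 0"
    and "\<And>\<beta>. \<beta> \<in> B \<Longrightarrow> W \<beta> = orth_proj (vec.span (\<phi> ` \<beta>)) /\<^sub>R (real k - 1)"
  shows "real CARD('d) = (real k - 1)\<^sup>2 * real v / ((real k)\<^sup>2 - 2 * real k + real v)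
    \<and> real (card B) = real v * (real v - 1) / (real k * (real k - 1)) * real lam
    \<and> (\<forall>\<beta>\<in>B. trace (W \<beta>) = 1 \<and> trace (W \<beta> ** W \<beta>) = of_real (1 / (real k - 1)))
    \<and> (\<forall>\<beta>\<in>B. \<forall>\<beta>'\<in>B. trace (W \<beta> ** W \<beta>') \<in> \<real>)
    \<and> (k < v \<longrightarrow>
        (\<exists>\<beta>\<in>B. \<exists>\<beta>'\<in>B. \<beta> \<noteq> \<beta>')
        \<and> Max {rc_re (trace (W \<beta> ** W \<beta>')) | \<beta> \<beta>'. \<beta> \<in> B \<and> \<beta>' \<in> B \<and> \<beta> \<noteq> \<beta>'}
          = 1 / real CARD('d))"
proof -
  obtain r c a where span: "vec.span (\<phi> ` J) = UNIV" and "finite J"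
    and "\<forall>j\<in>J. norm (\<phi> j) = r"
    and "\<forall>j\<in>J. \<forall>l\<in>J. j \<noteq> l \<longrightarrow> norm (rc_inner (\<phi> j) (\<phi> l)) = c"
    and "\<forall>x\<in>UNIV. (\<Sum>j\<in>J. rc_inner (\<phi> j) x *s \<phi> j) = a *s x"
    using assms(1) unfolding etf_def by (elim exE conjE) (rule that)
  then have r: "\<And>j. j \<in> J \<Longrightarrow> norm (\<phi> j) = r"
    and c: "\<And>j l. j \<in> J \<Longrightarrow> l \<in> J \<Longrightarrow> j \<noteq> l \<Longrightarrow> norm (rc_inner (\<phi> j) (\<phi> l)) = c"
    and a: "\<And>x. (\<Sum>j\<in>J. rc_inner (\<phi> j) x *s \<phi> j) = a *s x"
    by simp_all
  have "card J = v" using assms(3) by (simp add: simple_bibd_def)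
  have blocks: "\<beta> \<subseteq> J" "card \<beta> = k" "is_simplex \<phi> \<beta>" "finite \<beta>" if "\<beta> \<in> B" for \<beta>
  proof -
    show "\<beta> \<subseteq> J" "is_simplex \<phi> \<beta>"
      using that unfolding assms(2) simplex_binder_def by simp_all
    then show "finite \<beta>" using \<open>finite J\<close> finite_subset by blast
    show "card \<beta> = k" using assms(3) that by (simp add: simple_bibd_def)
  qed
  let ?d = "real CARD('d)" and ?K = "real k - 1"
  have K: "?K \<ge> 1" using \<open>k \<ge> 2\<close> by simp
  have r0: "r \<noteq> 0" and v0: "v > 0"
    and welch: "?d * (r ^ 4 + (real v - 1) * c\<^sup>2) = real v * r ^ 4"
    using etf_welch[OF span \<open>finite J\<close> r c a] unfolding \<open>card J = v\<close> by simp_all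
  have frame: "?K * c = r\<^sup>2"
    "\<And>i. i \<in> \<beta> \<Longrightarrow> frame_matrix \<beta> \<phi> *v \<phi> i = of_real (r\<^sup>2 + c) *s \<phi> i" if "\<beta> \<in> B" for \<beta>
  proof -
    have J: "j \<in> J" if "j \<in> \<beta>" for j using blocks(1)[OF \<open>\<beta> \<in> B\<close>] that by blast
    have card: "card \<beta> \<ge> 2" using blocks(2)[OF that] \<open>k \<ge> 2\<close> by simp
    note sf = simplex_frame[OF blocks(3)[OF that] card r[OF J] c[OF J J]]
    show "?K * c = r\<^sup>2" using sf(1) blocks(2)[OF that] by simp
    show "frame_matrix \<beta> \<phi> *v \<phi> i = of_real (r\<^sup>2 + c) *s \<phi> i" if "i \<in> \<beta>" for i
      using sf(2) that by simp
  qed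
  \<comment> \<open>The Welch identity is linear and homogeneous in \<open>r ^ 4\<close> and
    \<open>c\<^sup>2\<close>, so this relation allows \<open>c\<close> to be cancelled.\<close>
  have r4: "r ^ 4 = ?K\<^sup>2 * c\<^sup>2" if "B \<noteq> {}"
  proof -
    have "?K * c = r\<^sup>2" using frame(1) that by blast
    then have "(?K * c)\<^sup>2 = (r\<^sup>2)\<^sup>2" by simp
    then show ?thesis by (simp add: power_mult_distrib flip: power_mult)
  qed
  \<comment> \<open>The frame bound of a block is \<open>r\<^sup>2 + c\<close>; multiplied by
    \<open>k - 1\<close> it becomes \<open>k * r\<^sup>2\<close>, because
    \<open>(k - 1) * c = r\<^sup>2\<close>.\<close>
  have W: "W \<beta> = inverse (real k * r\<^sup>2) *\<^sub>R frame_matrix \<beta> \<phi>" if "\<beta> \<in> B" for \<beta>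
  proof -
    have "c = r\<^sup>2 / ?K" using frame(1)[OF that] K by (simp add: field_simps)
    then have "c > 0" using r0 K by simp
    then have "r\<^sup>2 + c \<noteq> 0" using zero_le_power2[of r] by linarith
    then have "W \<beta> = inverse ((r\<^sup>2 + c) * ?K) *\<^sub>R frame_matrix \<beta> \<phi>"
      using assms(7)[OF that] orth_proj_tight_frame[OF _ frame(2)[OF that]] by (simp add: mult.commute)
    moreover have "(r\<^sup>2 + c) * ?K = real k * r\<^sup>2"
      using frame(1)[OF that] by (simp add: algebra_simps)
    ultimately show ?thesis by simp
  qed
  have tr1: "trace (W \<beta>) = 1" if "\<beta> \<in> B" for \<beta>
  proof -
    have "trace (frame_matrix \<beta> \<phi>) = (\<Sum>j\<in>\<beta>. of_real (r\<^sup>2))"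
      unfolding trace_frame_matrix using r blocks(1)[OF that] by (intro sum.cong) auto
    then have "trace (frame_matrix \<beta> \<phi>) = of_real (real k * r\<^sup>2)"
      using blocks[OF that] by simp
    then have "trace (W \<beta>) = of_real (inverse (real k * r\<^sup>2) * (real k * r\<^sup>2))"
      by (simp only: W[OF that] trace_scaleR scaleR_conv_of_real[where 'a='a] of_real_mult)
    also have "inverse (real k * r\<^sup>2) * (real k * r\<^sup>2) = 1"
      using r0 \<open>k \<ge> 2\<close> by (intro left_inverse) simp
    finally show ?thesis by simp
  qed
  have tr2: "trace (W \<beta> ** W \<beta>')
      = of_real ((1 + real (card (\<beta> \<inter> \<beta>')) * (real k - 2) / real k) / ?K\<^sup>2)"
    if "\<beta> \<in> B" "\<beta>' \<in> B" for \<beta> \<beta>'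
  proof -
    let ?m = "real (card (\<beta> \<inter> \<beta>'))"
    have J: "j \<in> J" if "j \<in> \<beta> \<or> j \<in> \<beta>'" for j
      using that blocks(1)[OF \<open>\<beta> \<in> B\<close>] blocks(1)[OF \<open>\<beta>' \<in> B\<close>] by blast
    have gram: "(\<Sum>j\<in>\<beta>. \<Sum>l\<in>\<beta>'. (norm (rc_inner (\<phi> j) (\<phi> l)))\<^sup>2)
        = ?m * r ^ 4 + (real (card \<beta>) * real (card \<beta>') - ?m) * c\<^sup>2"
      by (rule equiangular_sum) (use blocks(4) that r c J in auto)
    have "trace (W \<beta> ** W \<beta>') = of_real (inverse (real k * r\<^sup>2) * inverse (real k * r\<^sup>2)
        * (?m * r ^ 4 + (real k * real k - ?m) * c\<^sup>2))"
      by (simp only: W[OF that(1)] W[OF that(2)] matrix_mult_scaleR trace_scaleR trace_frame_matrix_mult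
          scaleR_conv_of_real[where 'a='a] of_real_mult gram blocks(2)[OF that(1)] blocks(2)[OF that(2)])
    also have "inverse (real k * r\<^sup>2) * inverse (real k * r\<^sup>2)
        * (?m * r ^ 4 + (real k * real k - ?m) * c\<^sup>2)
        = inverse (real k * ?K) * inverse (real k * ?K) * (?m * ?K\<^sup>2 + (real k * real k - ?m))"
    proof -
      \<comment> \<open>Substituting \<open>r\<^sup>2 = (k - 1) * c\<close> makes numerator and
        denominator multiples of \<open>c\<^sup>2\<close>, which cancels.\<close>
      have c': "c \<noteq> 0" using frame(1)[OF that(1)] r0 by auto
      have r4': "r ^ 4 = ?K\<^sup>2 * c\<^sup>2" using r4 that by blast
      have poly: "?m * r ^ 4 + (real k * real k - ?m) * c\<^sup>2 = (?m * ?K\<^sup>2 + (real k * real k - ?m)) * (c * c)"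
        unfolding r4' by (simp add: algebra_simps power2_eq_square)
      have kr: "real k * r\<^sup>2 = (real k * ?K) * c"
        by (simp only: frame(1)[OF that(1), symmetric] mult.assoc)
      have "inverse (p * c) * inverse (p * c) * (x * (c * c)) = inverse p * inverse p * x" for p x
        using c' by (cases "p = 0") (simp_all add: field_simps)
      then show ?thesis unfolding kr poly .
    qed
    also have "\<dots> = (1 + ?m * (real k - 2) / real k) / ?K\<^sup>2"
    proof -
      \<comment> \<open>Expanding the left side gives \<open>k\<^sup>2 + m * k * (k - 2)\<close>,
        from which \<open>k\<^sup>2\<close> is factored out.\<close>
      have poly: "?m * ?K\<^sup>2 + (real k * real k - ?m) = real k * real k * (1 + ?m * (real k - 2) / real k)"
        using \<open>k \<ge> 2\<close> by (simp add: field_simps power2_eq_square)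
      have "inverse (real k * q) * inverse (real k * q) * (real k * real k * x) = x / q\<^sup>2" for q x
        using \<open>k \<ge> 2\<close> by (cases "q = 0") (simp_all add: field_simps power2_eq_square)
      then show ?thesis unfolding poly .
    qed
    finally show ?thesis .
  qed
  have denom: "(real k)\<^sup>2 - 2 * real k + real v = ?K\<^sup>2 + (real v - 1)"
    by (simp add: power2_eq_square algebra_simps)
  have denom_pos: "?K\<^sup>2 + (real v - 1) > 0"
    using K v0 by (intro add_pos_nonneg) auto
  \<comment> \<open>With no blocks there is no simplex relating \<open>r\<close> to
    \<open>c\<close>; but then \<open>lam > 0\<close> forces \<open>v = 1\<close>, and the Welch
    identity reduces to \<open>d = 1\<close>.\<close>
  have dim_eq: "?d * (?K\<^sup>2 + (real v - 1)) = ?K\<^sup>2 * real v"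
  proof (cases "B = {}")
    case True
    have "v \<le> 1"
    proof (rule ccontr)
      assume "\<not> v \<le> 1"
      then obtain x y where "x \<in> J" "y \<in> J" "x \<noteq> y"
        using \<open>card J = v\<close> card_le_Suc0_iff_eq[OF \<open>finite J\<close>] by auto
      then have "card {b \<in> B. x \<in> b \<and> y \<in> b} = lam"
        using assms(3) by (simp add: simple_bibd_def)
      then show False using True \<open>lam > 0\<close> by simp
    qed
    then have "v = 1" using v0 by simp
    then show ?thesis using welch r0 by simp
  next
    case False
    then have f: "?K * c = r\<^sup>2" using frame(1) by blast
    have "c \<noteq> 0" using f r0 by auto
    have "(?d * (?K\<^sup>2 + (real v - 1))) * c\<^sup>2 = (?K\<^sup>2 * real v) * c\<^sup>2"
      using welch unfolding r4[OF False] by (simp add: algebra_simps)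
    then show ?thesis using \<open>c \<noteq> 0\<close> by simp
  qed
  have dim: "?d = ?K\<^sup>2 * real v / ((real k)\<^sup>2 - 2 * real k + real v)"
    unfolding denom using dim_eq denom_pos
    by (subst nonzero_eq_divide_eq) (simp_all only: less_imp_neq[symmetric] not_False_eq_True)
  have "real (card B * (k * (k - 1))) = real (v * (v - 1) * lam)"
    using simple_bibd_card_blocks[OF assms(3)] by simp
  then have "real (card B) * (real k * ?K) = real v * (real v - 1) * real lam"
    using \<open>k \<ge> 2\<close> v0 by (simp add: of_nat_diff)
  then have card_B: "real (card B) = real v * (real v - 1) / (real k * ?K) * real lam"
    unfolding times_divide_eq_left using \<open>k \<ge> 2\<close> K
    by (subst nonzero_eq_divide_eq) (simp_all only: mult_eq_0_iff, auto)
  have tr_square: "trace (W \<beta> ** W \<beta>) = of_real (1 / ?K)" if "\<beta> \<in> B" for \<beta>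
  proof -
    have "1 + real k * (real k - 2) / real k = ?K"
      using \<open>k \<ge> 2\<close> by simp
    moreover have "?K / ?K\<^sup>2 = 1 / ?K"
      by (simp only: power2_eq_square divide_divide_eq_left[symmetric]) (use K in simp)
    ultimately show ?thesis
      using tr2[OF that that] blocks(2)[OF that] by (simp only: Int_absorb)
  qed
  \<comment> \<open>For \<open>k \<ge> v\<close> the only possible block is all of \<open>J\<close>,
    so the maximum would range over no pairs; \<open>k < v\<close> supplies distinct blocks.\<close>
  have "(\<exists>\<beta>\<in>B. \<exists>\<beta>'\<in>B. \<beta> \<noteq> \<beta>')
    \<and> Max {rc_re (trace (W \<beta> ** W \<beta>')) | \<beta> \<beta>'. \<beta> \<in> B \<and> \<beta>' \<in> B \<and> \<beta> \<noteq> \<beta>'} = 1 / ?d"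
    if kv: "k < v"
  proof -
    have "k > 0" using \<open>k \<ge> 2\<close> by simp
    obtain b b' where b: "b \<in> B" "b' \<in> B" "b \<noteq> b'" "card (b \<inter> b') * v = k\<^sup>2"
      and le: "\<And>c c'. c \<in> B \<Longrightarrow> c' \<in> B \<Longrightarrow> c \<noteq> c' \<Longrightarrow> card (c \<inter> c') * v \<le> k\<^sup>2"
      by (rule affine_design_intersections[OF assms(3,4) \<open>k > 0\<close> \<open>lam > 0\<close> kv]) (rule that)
    let ?g = "\<lambda>m. (1 + m * (real k - 2) / real k) / ?K\<^sup>2"
    have "1 / ?d = (?K\<^sup>2 + (real v - 1)) / (?K\<^sup>2 * real v)"
      using dim denom by simp
    also have "\<dots> = ?g ((real k)\<^sup>2 / real v)"
    proof -
      \<comment> \<open>The numerator is \<open>v + k * (k - 2)\<close>, so the value of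
        \<open>1 / d\<close> is the trace formula at the intersection size of nonparallel
        blocks.\<close>
      have "(?K\<^sup>2 + (real v - 1)) / real v = 1 + (real k)\<^sup>2 / real v * (real k - 2) / real k"
        using v0 \<open>k \<ge> 2\<close> by (simp add: field_simps power2_eq_square)
      then show ?thesis by (simp add: mult.commute[of "?K\<^sup>2"] flip: divide_divide_eq_left)
    qed
    finally have d: "1 / ?d = ?g ((real k)\<^sup>2 / real v)" .
    have tr: "rc_re (trace (W \<beta> ** W \<beta>')) = ?g (real (card (\<beta> \<inter> \<beta>')))"
      if "\<beta> \<in> B" "\<beta>' \<in> B" for \<beta> \<beta>'
      by (simp only: tr2[OF that] rc_re_of_real)
    have "real (card (b \<inter> b')) * real v = (real k)\<^sup>2"
      using b(4) by (metis of_nat_mult of_nat_power)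
    then have m: "real (card (b \<inter> b')) = (real k)\<^sup>2 / real v"
      using v0 by (simp add: field_simps)
    let ?T = "{rc_re (trace (W \<beta> ** W \<beta>')) | \<beta> \<beta>'. \<beta> \<in> B \<and> \<beta>' \<in> B \<and> \<beta> \<noteq> \<beta>'}"
    have "Max ?T = 1 / ?d"
    proof (rule Max_eqI)
      have "?T \<subseteq> (\<lambda>(\<beta>, \<beta>'). rc_re (trace (W \<beta> ** W \<beta>'))) ` (B \<times> B)"
        by auto
      then show "finite ?T"
        by (rule finite_subset) (simp add: simple_bibd_finite[OF assms(3)])
      have "1 / ?d = rc_re (trace (W b ** W b'))"
        by (simp only: tr[OF b(1,2)] m d)
      then show "1 / ?d \<in> ?T"
        using b(1,2,3) by blast
      fix y assume "y \<in> ?T"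
      then obtain \<beta> \<beta>' where \<beta>: "\<beta> \<in> B" "\<beta>' \<in> B" "\<beta> \<noteq> \<beta>'"
        and y: "y = rc_re (trace (W \<beta> ** W \<beta>'))"
        by blast
      have "real (card (\<beta> \<inter> \<beta>') * v) \<le> real (k\<^sup>2)"
        using le[OF \<beta>] by (simp only: of_nat_le_iff)
      then have m_le: "real (card (\<beta> \<inter> \<beta>')) \<le> (real k)\<^sup>2 / real v"
        using v0 by (simp add: pos_le_divide_eq)
      \<comment> \<open>Nonnegativity of this coefficient makes \<open>?g\<close> nondecreasing in
        the intersection size, so the bound \<open>k\<^sup>2 / v\<close> on that size bounds the
        trace.\<close>
      have "0 \<le> real k - 2" using \<open>k \<ge> 2\<close> by simp
      then show "y \<le> 1 / ?d"
        unfolding y tr[OF \<beta>(1,2)] d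
        by (intro divide_right_mono add_left_mono mult_right_mono m_le) simp_all
    qed
    then show ?thesis using b by blast
  qed
  moreover have "trace (W \<beta> ** W \<beta>') \<in> \<real>" if "\<beta> \<in> B" "\<beta>' \<in> B" for \<beta> \<beta>'
    unfolding tr2[OF that] by (rule Reals_of_real)
  ultimately show ?thesis
    using dim card_B tr1 tr_square by blast
qed

end
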